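(* Let $H$ be a finite-dimensional flip-Hopf $*$-algebra over $\mathbb C$ with antipode $S$, right-invariant integral $\int:H\to\mathbb C$ and left integral element $\Lambda\in H$, normalised so that $\int\Lambda=1$, and suppose $$\int h^*=\overline{\int Sh}\quad\text{for all }h\in H,\qquad\Lambda^*=S\Lambda.$$ Let $\tilde H$ be the associated Hopf algebra of the F-Hopf algebra induced by $H$, with antipode $\tilde S$, and suppose that $\tilde S^2=S^2$ as linear maps on the common underlying vector space. Then $\tilde H$ is a flip-Hopf $*$-algebra, for some $*$-operation $\tilde *$ (not necessarily equal to $*$), with the same associated antilinear automorphism, i.e. $\tilde S\circ\tilde *=S\circ*$.
   Context: A flip-Hopf $*$-algebra is a Hopf algebra over $\mathbb C$ whose algebra is a $*$-algebra (antilinear anti-algebra involution $*$) such that $\Delta\circ*=\dagger\circ\Delta$, $\overline{\epsilon(h)}=\epsilon(h^* )$ and $S\circ*=*\circ S$, where $\dagger=\mathrm{flip}\circ( *\otimes* )$. Its associated antilinear Hopf algebra automorphism is $\theta=S\circ*$. Write $\Delta h=h_1\otimes h_2$. Right-invariant integral: $(\int\otimes\mathrm{id})\Delta=1\int$. Left integral element: $h\Lambda=\epsilon(h)\Lambda$. The associated Hopf algebra $\tilde H$ is the same vector space as $H$ with product, unit, coproduct and counit $$h\bullet h'=h_1\int(Sh_2)h',\qquad1_{\tilde H}=\Lambda,\qquad\Delta_{\tilde H}h=\Lambda_1\otimes(S\Lambda_2)h,\qquad\epsilon_{\tilde H}(h)=\int h,$$ and antipode $\tilde Sh=\Lambda_1\int\Lambda_2h$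 (it is known that this is a Hopf algebra). *)

theory Defs
  imports Complex_Main "HOL-Library.Poly_Mapping"
begin

section \<open>Complex vector spaces\<close>

class complex_vector = ab_group_add +
  fixes scaleC :: "complex \<Rightarrow> 'a \<Rightarrow> 'a"  (infixr \<open>*\<^sub>C\<close> 75)
  assumes scaleC_add_right: "c *\<^sub>C (x + y) = c *\<^sub>C x + c *\<^sub>C y"
    and scaleC_add_left: "(c + d) *\<^sub>C x = c *\<^sub>C x + d *\<^sub>C x"
    and scaleC_scaleC: "c *\<^sub>C (d *\<^sub>C x) = (c * d) *\<^sub>C x"
    and scaleC_one: "1 *\<^sub>C x = x"

global_interpretation complex_vector: vector_space "scaleC :: complex \<Rightarrow> 'a \<Rightarrow> 'a::complex_vector"
  by unfold_locales (simp_all add: scaleC_add_right scaleC_add_left scaleC_scaleC scaleC_one)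

instantiation complex :: complex_vector
begin
definition scaleC_complex_def: "scaleC c (x::complex) = c * x"
instance by intro_classes (simp_all add: scaleC_complex_def algebra_simps)
end

abbreviation clinear :: "('a::complex_vector \<Rightarrow> 'b::complex_vector) \<Rightarrow> bool"
  where "clinear \<equiv> Vector_Spaces.linear scaleC scaleC"

definition antilinear :: "('a::complex_vector \<Rightarrow> 'b::complex_vector) \<Rightarrow> bool"
  where "antilinear f \<longleftrightarrow>
    (\<forall>x y. f (x + y) = f x + f y) \<and> (\<forall>c x. f (c *\<^sub>C x) = cnj c *\<^sub>C f x)"

section \<open>Tensor products over the complex numbers\<close>

text \<open>The tensor product is the free abelian group on the pairs, modulo the subgroup generated by
  the relations of biadditivity and of balancedness over the complex numbers.\<close>

inductive_set tensor_relations :: "(('a::complex_vector \<times> 'b::complex_vector) \<Rightarrow>\<^sub>0 int) set" where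
  zero: "0 \<in> tensor_relations"
| diff: "x \<in> tensor_relations \<Longrightarrow> y \<in> tensor_relations \<Longrightarrow> x - y \<in> tensor_relations"
| add_left: "frag_of (a + a', b) - frag_of (a, b) - frag_of (a', b) \<in> tensor_relations"
| add_right: "frag_of (a, b + b') - frag_of (a, b) - frag_of (a, b') \<in> tensor_relations"
| balanced: "frag_of (c *\<^sub>C a, b) - frag_of (a, c *\<^sub>C b) \<in> tensor_relations"

lemma tensor_relations_uminus: "x \<in> tensor_relations \<Longrightarrow> - x \<in> tensor_relations"
  using tensor_relations.diff[OF tensor_relations.zero] by force

lemma tensor_relations_add:
  "x \<in> tensor_relations \<Longrightarrow> y \<in> tensor_relations \<Longrightarrow> x + y \<in> tensor_relations"
  using tensor_relations.diff[OF _ tensor_relations_uminus] by force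

definition tensor_eq ::
    "(('a::complex_vector \<times> 'b::complex_vector) \<Rightarrow>\<^sub>0 int) \<Rightarrow> (('a \<times> 'b) \<Rightarrow>\<^sub>0 int) \<Rightarrow> bool"
  where "tensor_eq x y \<longleftrightarrow> x - y \<in> tensor_relations"

quotient_type (overloaded) ('a, 'b) tensor =
    "('a::complex_vector \<times> 'b::complex_vector) \<Rightarrow>\<^sub>0 int" / tensor_eq
proof (rule equivpI)
  show "reflp (tensor_eq :: (('a \<times> 'b) \<Rightarrow>\<^sub>0 int) \<Rightarrow> _)"
    by (simp add: reflp_def tensor_eq_def tensor_relations.zero)
  show "symp (tensor_eq :: (('a \<times> 'b) \<Rightarrow>\<^sub>0 int) \<Rightarrow> _)"
    by (metis minus_diff_eq symp_def tensor_eq_def tensor_relations_uminus)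
  show "transp (tensor_eq :: (('a \<times> 'b) \<Rightarrow>\<^sub>0 int) \<Rightarrow> _)"
  proof (rule transpI)
    fix x y z :: "('a \<times> 'b) \<Rightarrow>\<^sub>0 int"
    assume "tensor_eq x y" "tensor_eq y z"
    then have "(x - y) + (y - z) \<in> tensor_relations"
      unfolding tensor_eq_def by (rule tensor_relations_add)
    then show "tensor_eq x z" by (simp add: tensor_eq_def)
  qed
qed

lift_definition tensor :: "'a::complex_vector \<Rightarrow> 'b::complex_vector \<Rightarrow> ('a, 'b) tensor"  (infixr \<open>\<otimes>\<close> 76)
  is "\<lambda>a b. frag_of (a, b)" .

definition frag_scale ::
    "complex \<Rightarrow> (('a::complex_vector \<times> 'b::complex_vector) \<Rightarrow>\<^sub>0 int) \<Rightarrow> (('a \<times> 'b) \<Rightarrow>\<^sub>0 int)"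
  where "frag_scale c = frag_extend (\<lambda>(a, b). frag_of (c *\<^sub>C a, b))"

lemma frag_scale_relations:
  "x \<in> tensor_relations \<Longrightarrow> frag_scale c x \<in> tensor_relations"
proof (induction rule: tensor_relations.induct)
  case (balanced d a b)
  have "frag_of (d *\<^sub>C c *\<^sub>C a, b) - frag_of (c *\<^sub>C a, d *\<^sub>C b) \<in> tensor_relations"
    by (rule tensor_relations.balanced)
  then show ?case
    by (simp add: frag_scale_def frag_extend_diff scaleC_scaleC mult.commute)
qed (auto simp: frag_scale_def frag_extend_diff scaleC_add_right
      intro: tensor_relations.intros)

lemma frag_scale_add_left: "tensor_eq (frag_scale (c + d) x) (frag_scale c x + frag_scale d x)"
  unfolding tensor_eq_def
proof (induction x rule: frag_induction[OF subset_UNIV])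
  case (2 x)
  then show ?case
    by (auto simp: frag_scale_def scaleC_add_left diff_diff_eq[symmetric]
        intro: tensor_relations.intros split: prod.splits)
next
  case (3 a b)
  have "frag_scale (c + d) (a - b) - (frag_scale c (a - b) + frag_scale d (a - b))
    = (frag_scale (c + d) a - (frag_scale c a + frag_scale d a))
      - (frag_scale (c + d) b - (frag_scale c b + frag_scale d b))"
    by (simp add: frag_scale_def frag_extend_diff)
  then show ?case using 3 by (metis tensor_relations.diff)
qed (simp_all add: frag_scale_def tensor_relations.zero)

lemma frag_scale_scale: "frag_scale c (frag_scale d x) = frag_scale (c * d) x"
  by (induction x rule: frag_induction[OF subset_UNIV])
    (auto simp: frag_scale_def frag_extend_diff scaleC_scaleC)

lemma frag_scale_one: "frag_scale 1 x = x"
  by (induction x rule: frag_induction[OF subset_UNIV])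
    (auto simp: frag_scale_def frag_extend_diff scaleC_one)

instantiation tensor :: (complex_vector, complex_vector) complex_vector
begin

lift_definition zero_tensor :: "('a, 'b) tensor" is 0 .

lift_definition plus_tensor :: "('a, 'b) tensor \<Rightarrow> ('a, 'b) tensor \<Rightarrow> ('a, 'b) tensor" is "(+)"
  unfolding tensor_eq_def by (metis add_diff_add tensor_relations_add)

lift_definition uminus_tensor :: "('a, 'b) tensor \<Rightarrow> ('a, 'b) tensor" is uminus
  unfolding tensor_eq_def by (metis minus_diff_minus tensor_relations_uminus)

lift_definition minus_tensor :: "('a, 'b) tensor \<Rightarrow> ('a, 'b) tensor \<Rightarrow> ('a, 'b) tensor" is "(-)"
proof -
  fix x y x2 y2 :: "('a \<times> 'b) \<Rightarrow>\<^sub>0 int"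
  assume "tensor_eq x y" "tensor_eq x2 y2"
  then have "(x - y) - (x2 - y2) \<in> tensor_relations"
    unfolding tensor_eq_def by (rule tensor_relations.diff)
  then show "tensor_eq (x - x2) (y - y2)"
    by (simp add: tensor_eq_def algebra_simps)
qed

text \<open>\<open>c *\<^sub>C (a \<otimes> b) = (c *\<^sub>C a) \<otimes> b\<close>\<close>

lift_definition scaleC_tensor :: "complex \<Rightarrow> ('a, 'b) tensor \<Rightarrow> ('a, 'b) tensor" is frag_scale
  unfolding tensor_eq_def by (metis frag_scale_relations frag_scale_def frag_extend_diff)

instance
proof
  fix x y z :: "('a, 'b) tensor" and c d :: complex
  have eqI: "u = v \<Longrightarrow> tensor_eq u v" for u v :: "('a \<times> 'b) \<Rightarrow>\<^sub>0 int"
    by (simp add: tensor_eq_def tensor_relations.zero)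
  show "x + y + z = x + (y + z)" by transfer (simp add: eqI add.assoc)
  show "x + y = y + x" by transfer (simp add: eqI add.commute)
  show "0 + x = x" by transfer (simp add: eqI)
  show "- x + x = 0" by transfer (simp add: eqI)
  show "x - y = x + - y" by transfer (simp add: eqI)
  show "c *\<^sub>C (x + y) = c *\<^sub>C x + c *\<^sub>C y"
    by transfer (simp add: eqI frag_scale_def frag_extend_add)
  show "(c + d) *\<^sub>C x = c *\<^sub>C x + d *\<^sub>C x" by transfer (rule frag_scale_add_left)
  show "c *\<^sub>C d *\<^sub>C x = (c * d) *\<^sub>C x" by transfer (simp add: eqI frag_scale_scale)
  show "1 *\<^sub>C x = x" by transfer (simp add: eqI frag_scale_one)
qed

end

lemma tensor_add_left: "(a + a') \<otimes> b = a \<otimes> b + a' \<otimes> b"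
  by transfer (simp add: tensor_eq_def diff_diff_eq[symmetric] tensor_relations.add_left)

lemma tensor_add_right: "a \<otimes> (b + b') = a \<otimes> b + a \<otimes> b'"
  by transfer (simp add: tensor_eq_def diff_diff_eq[symmetric] tensor_relations.add_right)

lemma scaleC_tensor_left: "(c *\<^sub>C a) \<otimes> b = c *\<^sub>C (a \<otimes> b)"
  by transfer (simp add: tensor_eq_def frag_scale_def tensor_relations.zero)

lemma scaleC_tensor_right: "a \<otimes> (c *\<^sub>C b) = c *\<^sub>C (a \<otimes> b)"
  unfolding scaleC_tensor_left[symmetric]
  by transfer
    (use tensor_relations_uminus[OF tensor_relations.balanced] in \<open>force simp: tensor_eq_def\<close>)

text \<open>The additive map \<open>a \<otimes> b \<mapsto> f a b\<close> induced by a balanced biadditive \<open>f\<close>. Balancedness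
  (rather than bilinearity) is what is required so that the same operator also produces the
  antilinear maps on tensor products. The value is a junk value if \<open>f\<close> is not balanced.\<close>

definition balanced :: "('a::complex_vector \<Rightarrow> 'b::complex_vector \<Rightarrow> 'c::ab_group_add) \<Rightarrow> bool"
  where "balanced f \<longleftrightarrow>
    (\<forall>a a' b. f (a + a') b = f a b + f a' b) \<and>
    (\<forall>a b b'. f a (b + b') = f a b + f a b') \<and>
    (\<forall>c a b. f (c *\<^sub>C a) b = f a (c *\<^sub>C b))"

definition frag_lift ::
    "('a::complex_vector \<Rightarrow> 'b::complex_vector \<Rightarrow> 'c::complex_vector) \<Rightarrow> (('a \<times> 'b) \<Rightarrow>\<^sub>0 int) \<Rightarrow> 'c"
  where "frag_lift f x =
    (\<Sum>p\<in>Poly_Mapping.keys x. of_int (Poly_Mapping.lookup x p) *\<^sub>C f (fst p) (snd p))"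

definition tensor_lift ::
    "('a::complex_vector \<Rightarrow> 'b::complex_vector \<Rightarrow> 'c::complex_vector) \<Rightarrow> ('a, 'b) tensor \<Rightarrow> 'c"
  where "tensor_lift f t = frag_lift f (rep_tensor t)"

lemma frag_lift_diff: "frag_lift f (x - y) = frag_lift f x - frag_lift f y"
proof -
  have *: "frag_lift f z =
      (\<Sum>p\<in>K. of_int (Poly_Mapping.lookup z p) *\<^sub>C f (fst p) (snd p))"
    if "finite K" "Poly_Mapping.keys z \<subseteq> K" for z K
    unfolding frag_lift_def using that
    by (intro sum.mono_neutral_left) (auto simp: in_keys_iff)
  let ?K = "Poly_Mapping.keys x \<union> Poly_Mapping.keys y"
  have "Poly_Mapping.keys (x - y) \<subseteq> ?K" by (auto simp: in_keys_iff lookup_minus)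
  then show ?thesis
    by (simp add: *[of ?K] lookup_minus complex_vector.scale_left_diff_distrib sum_subtractf)
qed

lemma frag_lift_of [simp]: "frag_lift f (frag_of (a, b)) = f a b"
  by (simp add: frag_lift_def scaleC_one)

lemma frag_lift_relations:
  assumes "balanced f" "x \<in> tensor_relations"
  shows "frag_lift f x = 0"
  using assms(2)
proof induction
  case zero
  then show ?case by (simp add: frag_lift_def)
qed (use assms(1) in \<open>auto simp: frag_lift_diff balanced_def\<close>)

lemma tensor_lift_abs:
  assumes "balanced f"
  shows "tensor_lift f (abs_tensor x) = frag_lift f x"
proof -
  have "tensor_eq (rep_tensor (abs_tensor x)) x"
    by (rule Quotient3_rep_abs[OF Quotient3_tensor]) (simp add: tensor_eq_def tensor_relations.zero)
  then have "frag_lift f (rep_tensor (abs_tensor x) - x) = 0"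
    unfolding tensor_eq_def by (rule frag_lift_relations[OF assms])
  then show ?thesis by (simp add: tensor_lift_def frag_lift_diff)
qed

lemma tensor_lift_tensor: "balanced f \<Longrightarrow> tensor_lift f (a \<otimes> b) = f a b"
  by (simp add: tensor.abs_eq tensor_lift_abs)

lemma tensor_lift_diff: "balanced f \<Longrightarrow> tensor_lift f (s - t) = tensor_lift f s - tensor_lift f t"
  by (induct s rule: tensor.abs_induct, induct t rule: tensor.abs_induct)
    (simp add: minus_tensor.abs_eq tensor_lift_abs frag_lift_diff)

text \<open>\<open>f\<close> and \<open>g\<close> should be both linear or both antilinear.\<close>

definition tensor_map ::
    "('a::complex_vector \<Rightarrow> 'c::complex_vector) \<Rightarrow> ('b::complex_vector \<Rightarrow> 'd::complex_vector) \<Rightarrow>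
     ('a, 'b) tensor \<Rightarrow> ('c, 'd) tensor"
  where "tensor_map f g = tensor_lift (\<lambda>a b. f a \<otimes> g b)"

definition tensor_flip :: "('a::complex_vector, 'b::complex_vector) tensor \<Rightarrow> ('b, 'a) tensor"
  where "tensor_flip = tensor_lift (\<lambda>a b. b \<otimes> a)"

definition tensor_assoc ::
    "(('a::complex_vector, 'b::complex_vector) tensor, 'c::complex_vector) tensor \<Rightarrow>
     ('a, ('b, 'c) tensor) tensor"
  where "tensor_assoc = tensor_lift (\<lambda>t c. tensor_lift (\<lambda>a b. a \<otimes> (b \<otimes> c)) t)"

definition tensor_mult ::
    "('a::complex_vector \<Rightarrow> 'a \<Rightarrow> 'a) \<Rightarrow> ('a, 'a) tensor \<Rightarrow> ('a, 'a) tensor \<Rightarrow> ('a, 'a) tensor"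
  where "tensor_mult m s t =
    tensor_lift (\<lambda>a b. tensor_lift (\<lambda>c d. m a c \<otimes> m b d) t) s"

section \<open>Hopf algebras\<close>

text \<open>The operations are explicit parameters because two Hopf algebra structures on one vector
  space have to be compared.\<close>

locale cx_algebra =
  fixes mult :: "'h::complex_vector \<Rightarrow> 'h \<Rightarrow> 'h" and one :: 'h
  assumes clinear_mult_left: "clinear (\<lambda>a. mult a b)"
    and clinear_mult_right: "clinear (mult a)"
    and mult_assoc: "mult (mult a b) c = mult a (mult b c)"
    and mult_one_left: "mult one a = a"
    and mult_one_right: "mult a one = a"

locale cx_coalgebra =
  fixes comult :: "'h::complex_vector \<Rightarrow> ('h, 'h) tensor" and counit :: "'h \<Rightarrow> complex"
  assumes clinear_comult: "clinear comult"
    and clinear_counit: "clinear counit"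
    and coassoc: "tensor_assoc (tensor_map comult id (comult h)) = tensor_map id comult (comult h)"
    and counit_left: "tensor_lift (\<lambda>a b. counit a *\<^sub>C b) (comult h) = h"
    and counit_right: "tensor_lift (\<lambda>a b. counit b *\<^sub>C a) (comult h) = h"

locale hopf_algebra = cx_algebra mult one + cx_coalgebra comult counit
  for mult :: "'h::complex_vector \<Rightarrow> 'h \<Rightarrow> 'h" and one :: 'h
    and comult :: "'h \<Rightarrow> ('h, 'h) tensor" and counit :: "'h \<Rightarrow> complex" +
  fixes antipode :: "'h \<Rightarrow> 'h"
  assumes comult_mult: "comult (mult a b) = tensor_mult mult (comult a) (comult b)"
    and comult_one: "comult one = one \<otimes> one"
    and counit_mult: "counit (mult a b) = counit a * counit b"
    and counit_one: "counit one = 1"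
    and clinear_antipode: "clinear antipode"
    and antipode_left: "tensor_lift mult (tensor_map antipode id (comult h)) = counit h *\<^sub>C one"
    and antipode_right: "tensor_lift mult (tensor_map id antipode (comult h)) = counit h *\<^sub>C one"

locale flip_hopf_star_algebra = hopf_algebra mult one comult counit antipode
  for mult :: "'h::complex_vector \<Rightarrow> 'h \<Rightarrow> 'h" and one :: 'h
    and comult :: "'h \<Rightarrow> ('h, 'h) tensor" and counit :: "'h \<Rightarrow> complex"
    and antipode :: "'h \<Rightarrow> 'h" +
  fixes star :: "'h \<Rightarrow> 'h"
  assumes antilinear_star: "antilinear star"
    and star_mult: "star (mult a b) = mult (star b) (star a)"
    and star_one: "star one = one"
    and star_star: "star (star a) = a"
    and comult_star: "comult (star h) = tensor_flip (tensor_map star star (comult h))"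
    and counit_star: "cnj (counit h) = counit (star h)"
    and antipode_star: "antipode (star h) = star (antipode h)"

definition right_invariant_integral ::
    "'h::complex_vector \<Rightarrow> ('h \<Rightarrow> ('h, 'h) tensor) \<Rightarrow> ('h \<Rightarrow> complex) \<Rightarrow> bool"
  where "right_invariant_integral one comult integ \<longleftrightarrow>
    clinear integ \<and>
    (\<forall>h. tensor_lift (\<lambda>a b. integ a *\<^sub>C b) (comult h) = integ h *\<^sub>C one)"

definition left_integral_element ::
    "('h::complex_vector \<Rightarrow> 'h \<Rightarrow> 'h) \<Rightarrow> ('h \<Rightarrow> complex) \<Rightarrow> 'h \<Rightarrow> bool"
  where "left_integral_element mult counit \<Lambda> \<longleftrightarrow> (\<forall>h. mult h \<Lambda> = counit h *\<^sub>C \<Lambda>)"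

section \<open>The associated Hopf algebra\<close>

text \<open>Its unit is \<open>\<Lambda>\<close> and its counit is the integral. The remaining operations are, in Sweedler
  notation,
    \<open>h \<bullet> h' = h\<^sub>1 \<integral>(S h\<^sub>2) h'\<close>,
    \<open>h \<mapsto> \<Lambda>\<^sub>1 \<otimes> (S \<Lambda>\<^sub>2) h\<close> and
    \<open>h \<mapsto> \<Lambda>\<^sub>1 \<integral>\<Lambda>\<^sub>2 h\<close>.\<close>

definition assoc_mult ::
    "('h::complex_vector \<Rightarrow> 'h \<Rightarrow> 'h) \<Rightarrow> ('h \<Rightarrow> ('h, 'h) tensor) \<Rightarrow> ('h \<Rightarrow> 'h) \<Rightarrow>
     ('h \<Rightarrow> complex) \<Rightarrow> 'h \<Rightarrow> 'h \<Rightarrow> 'h"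
  where "assoc_mult mult comult antipode integ h h' =
    tensor_lift (\<lambda>a b. integ (mult (antipode b) h') *\<^sub>C a) (comult h)"

definition assoc_comult ::
    "('h::complex_vector \<Rightarrow> 'h \<Rightarrow> 'h) \<Rightarrow> ('h \<Rightarrow> ('h, 'h) tensor) \<Rightarrow> ('h \<Rightarrow> 'h) \<Rightarrow>
     'h \<Rightarrow> 'h \<Rightarrow> ('h, 'h) tensor"
  where "assoc_comult mult comult antipode \<Lambda> h =
    tensor_map id (\<lambda>b. mult (antipode b) h) (comult \<Lambda>)"

definition assoc_antipode ::
    "('h::complex_vector \<Rightarrow> 'h \<Rightarrow> 'h) \<Rightarrow> ('h \<Rightarrow> ('h, 'h) tensor) \<Rightarrow>
     ('h \<Rightarrow> complex) \<Rightarrow> 'h \<Rightarrow> 'h \<Rightarrow> 'h"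
  where "assoc_antipode mult comult integ \<Lambda> h =
    tensor_lift (\<lambda>a b. integ (mult b h) *\<^sub>C a) (comult \<Lambda>)"

end

theory Submission
  imports Defs
begin

text \<open>
  The map \<open>h \<mapsto> (x \<mapsto> \<integral>x h)\<close> embeds the associated Hopf algebra into the linear dual of
  \<open>H\<close>: it carries \<open>\<bullet>\<close> to convolution, the new coproduct to the transpose of the opposite product
  and the new antipode to the transpose of \<open>S\<^sup>-\<^sup>1\<close>, so the Hopf algebra axioms can be checked after
  pairing. Here \<open>S\<close> is onto because \<open>x = \<integral>(x \<Lambda>\<^sub>1) S \<Lambda>\<^sub>2\<close>, hence bijective in finite dimension.
  The antilinear automorphism \<open>\<theta> = S \<circ> *\<close> fixes \<open>\<Lambda>\<close> and is compatible with the integral, so it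
  preserves every operation of the associated Hopf algebra. The new star is \<open>S'\<^sup>-\<^sup>1 \<circ> \<theta>\<close>; it is
  an involution because \<open>\<theta>\<^sup>2 = S\<^sup>2 = S'\<^sup>2\<close>.
\<close>

section \<open>Tensor calculus\<close>

lemma clinear_iff:
  "clinear f \<longleftrightarrow> (\<forall>x y. f (x + y) = f x + f y) \<and> (\<forall>c x. f (c *\<^sub>C x) = c *\<^sub>C f x)"
  by (simp add: Vector_Spaces.linear_iff complex_vector.vector_space_axioms)

lemma clinear_additive: "clinear f \<Longrightarrow> additive f"
  by (simp add: clinear_iff additive_def)

lemma antilinear_additive: "antilinear f \<Longrightarrow> additive f"
  by (simp add: antilinear_def additive_def)

lemma clinear_scale: "clinear f \<Longrightarrow> f (c *\<^sub>C x) = c *\<^sub>C f x"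
  by (simp add: clinear_iff)

text \<open>Stronger than \<open>balanced\<close>: that condition makes \<open>tensor_lift f\<close>
  additive, this one makes it complex linear.\<close>

definition cbilinear ::
    "('a::complex_vector \<Rightarrow> 'b::complex_vector \<Rightarrow> 'c::complex_vector) \<Rightarrow> bool"
  where "cbilinear f \<longleftrightarrow> (\<forall>b. clinear (\<lambda>a. f a b)) \<and> (\<forall>a. clinear (\<lambda>b. f a b))"

named_theorems lin

lemma cbilinearI [lin]:
  "(\<And>b. clinear (\<lambda>a. f a b)) \<Longrightarrow> (\<And>a. clinear (\<lambda>b. f a b)) \<Longrightarrow> cbilinear f"
  by (simp add: cbilinear_def)

lemma cbilinear_balanced: "cbilinear f \<Longrightarrow> balanced f"
  by (simp add: cbilinear_def balanced_def clinear_iff)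

text \<open>The tensor product is a quotient of a free abelian group, so elementary tensors generate
  it under subtraction alone; zero is \<open>0 \<otimes> 0 - 0 \<otimes> 0\<close>.\<close>

lemma tensor_induct [case_names tensor diff]:
  assumes "\<And>a b. P (a \<otimes> b)" "\<And>s t. P s \<Longrightarrow> P t \<Longrightarrow> P (s - t)"
  shows "P t"
proof (induct t rule: tensor.abs_induct)
  case (1 x)
  show ?case
  proof (induction x rule: frag_induction[OF subset_UNIV])
    case 1
    have "P (0 \<otimes> 0 - 0 \<otimes> 0)" using assms by blast
    then show ?case by (simp add: zero_tensor.abs_eq[symmetric])
  next
    case (2 x)
    then show ?case using assms(1)[of "fst x" "snd x"] by (simp add: tensor.abs_eq)
  next
    case (3 a b)
    then show ?case using assms(2) by (simp add: minus_tensor.abs_eq[symmetric])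
  qed
qed

lemma additive_scale_of_int:
  fixes f :: "'a::complex_vector \<Rightarrow> 'b::complex_vector"
  assumes "additive f"
  shows "f (of_int n *\<^sub>C x) = of_int n *\<^sub>C f x"
proof (induction n rule: int_induct[where k = 0])
  case base
  then show ?case by (simp add: additive.zero[OF assms])
next
  case (step1 i)
  then show ?case by (simp add: scaleC_add_left scaleC_one additive.add[OF assms])
next
  case (step2 i)
  then show ?case
    by (simp add: complex_vector.scale_left_diff_distrib scaleC_one additive.diff[OF assms])
qed

text \<open>A lift is an integer combination of values of \<open>f\<close> over one fixed
  representative, so any additive \<open>g\<close> passes through it, whatever \<open>f\<close> is.
  Asking only for additivity makes this usable for antilinear maps.\<close>

lemma additive_tensor_lift:
  fixes g :: "'c::complex_vector \<Rightarrow> 'd::complex_vector"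
  assumes "additive g"
  shows "g (tensor_lift f t) = tensor_lift (\<lambda>a b. g (f a b)) t"
  by (simp add: tensor_lift_def frag_lift_def additive.sum[OF assms]
      additive_scale_of_int[OF assms])

lemmas clinear_tensor_lift = additive_tensor_lift[OF clinear_additive]

lemma clinear_scaleC_left: "clinear (\<lambda>c. c *\<^sub>C x)"
  by (simp add: clinear_iff scaleC_add_left scaleC_complex_def scaleC_scaleC)

lemma tensor_lift_scaleC_left: "tensor_lift f t *\<^sub>C x = tensor_lift (\<lambda>a b. f a b *\<^sub>C x) t"
  by (rule clinear_tensor_lift[OF clinear_scaleC_left])

lemma tensor_lift_scaleC_right:
  "c *\<^sub>C tensor_lift f t = tensor_lift (\<lambda>a b. c *\<^sub>C f a b) t"
  by (rule clinear_tensor_lift) (simp add: clinear_iff scaleC_add_right scaleC_scaleC mult.commute)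

text \<open>Both sides are finite sums over the same two chosen representatives, hence no condition
  on \<open>f\<close>.\<close>

lemma tensor_lift_swap:
  "tensor_lift (\<lambda>a b. tensor_lift (f a b) s) t
    = tensor_lift (\<lambda>c d. tensor_lift (\<lambda>a b. f a b c d) t) s"
  unfolding tensor_lift_def frag_lift_def complex_vector.scale_sum_right scaleC_scaleC
  by (subst sum.swap) (simp add: mult.commute)

lemma tensor_lift_additive:
  assumes "balanced f"
  shows "additive (tensor_lift f)"
proof
  have zero: "tensor_lift f 0 = 0"
    using tensor_lift_diff[OF assms, of 0 0] by simp
  show "tensor_lift f (s + t) = tensor_lift f s + tensor_lift f t" for s t
    using tensor_lift_diff[OF assms, of s "0 - t"] tensor_lift_diff[OF assms, of 0 t]
    by (simp add: zero)
qed

lemma tensor_lift_linear: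
  assumes f: "cbilinear f"
  shows "clinear (tensor_lift f)"
proof -
  note additive = tensor_lift_additive[OF cbilinear_balanced[OF f]]
  have scale: "tensor_lift f (c *\<^sub>C t) = c *\<^sub>C tensor_lift f t" for c t
  proof (induction t rule: tensor_induct)
    case (tensor a b)
    then show ?case using f
      by (simp add: scaleC_tensor_left[symmetric] tensor_lift_tensor cbilinear_balanced)
        (simp add: cbilinear_def clinear_iff)
  next
    case (diff s t)
    then show ?case
      by (simp add: additive.diff[OF additive] complex_vector.scale_right_diff_distrib)
  qed
  show ?thesis by (simp add: clinear_iff additive.add[OF additive] scale)
qed

lemma tensor_lift_lift:
  "cbilinear f \<Longrightarrow>
    tensor_lift f (tensor_lift g t) = tensor_lift (\<lambda>a b. tensor_lift f (g a b)) t"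
  by (rule clinear_tensor_lift[OF tensor_lift_linear])

lemma lift_tensor: "cbilinear f \<Longrightarrow> tensor_lift f (a \<otimes> b) = f a b"
  by (rule tensor_lift_tensor[OF cbilinear_balanced])

section \<open>Closure rules for linear maps\<close>

lemma lin_id [lin]: "clinear (\<lambda>x. x)"
  by (simp add: clinear_iff)

lemma clinear_compose: "clinear g \<Longrightarrow> clinear f \<Longrightarrow> clinear (\<lambda>x. g (f x))"
  by (simp add: clinear_iff)

lemma lin_tensor_left [lin]: "clinear f \<Longrightarrow> clinear (\<lambda>x. f x \<otimes> c)"
  by (simp add: clinear_iff tensor_add_left scaleC_tensor_left)

lemma lin_tensor_right [lin]: "clinear f \<Longrightarrow> clinear (\<lambda>x. c \<otimes> f x)"
  by (simp add: clinear_iff tensor_add_right scaleC_tensor_right)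

lemma lin_scaleC_left [lin]: "clinear f \<Longrightarrow> clinear (\<lambda>x. f x *\<^sub>C y)"
  by (rule clinear_compose[OF clinear_scaleC_left])

lemma lin_scaleC_right [lin]: "clinear f \<Longrightarrow> clinear (\<lambda>x. c *\<^sub>C f x)"
  by (simp add: clinear_iff scaleC_add_right scaleC_scaleC mult.commute)

lemma lin_times_left [lin]: "clinear f \<Longrightarrow> clinear (\<lambda>x. f x * (c::complex))"
  by (simp add: clinear_iff scaleC_complex_def algebra_simps)

lemma lin_times_right [lin]: "clinear f \<Longrightarrow> clinear (\<lambda>x. (c::complex) * f x)"
  by (simp add: clinear_iff scaleC_complex_def algebra_simps)

text \<open>The tensor, hence its representative, stays fixed while the integrand varies, so
  linearity holds termwise.\<close>

lemma lin_lift_body [lin]: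
  assumes "\<And>a b. clinear (\<lambda>x. f x a b)"
  shows "clinear (\<lambda>x. tensor_lift (f x) t)"
proof -
  have "tensor_lift (f (x + y)) t = tensor_lift (f x) t + tensor_lift (f y) t" for x y
    using assms by (simp add: clinear_iff tensor_lift_def frag_lift_def scaleC_add_right
        sum.distrib)
  moreover have "tensor_lift (f (c *\<^sub>C x)) t = c *\<^sub>C tensor_lift (f x) t" for c x
    using assms by (simp add: clinear_iff tensor_lift_def frag_lift_def
        complex_vector.scale_sum_right scaleC_scaleC mult.commute)
  ultimately show ?thesis by (simp add: clinear_iff)
qed

lemma lin_lift_arg [lin]:
  "cbilinear f \<Longrightarrow> clinear g \<Longrightarrow> clinear (\<lambda>x. tensor_lift f (g x))"
  by (rule clinear_compose[OF tensor_lift_linear])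

lemma clinear_eq_tensor:
  assumes "clinear f" "clinear g" "\<And>a b. f (a \<otimes> b) = g (a \<otimes> b)"
  shows "f t = g t"
proof (induction t rule: tensor_induct)
  case (tensor a b)
  then show ?case by (rule assms)
next
  case (diff s t)
  then show ?case using assms(1,2) by (metis additive.diff clinear_additive)
qed

lemma tensor_lift_tensor_id: "tensor_lift (\<lambda>a b. a \<otimes> b) t = t"
  by (rule clinear_eq_tensor[where f = "tensor_lift (\<lambda>a b. a \<otimes> b)" and g = "\<lambda>x. x"])
    (intro lin | simp add: lift_tensor lin)+

section \<open>Evaluation on mapped, flipped and rebracketed tensors\<close>

lemma tensor_lift_map:
  "cbilinear f \<Longrightarrow> tensor_lift f (tensor_map u v t) = tensor_lift (\<lambda>a b. f (u a) (v b)) t"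
  by (simp add: tensor_map_def tensor_lift_lift lift_tensor)

lemma tensor_lift_flip:
  "cbilinear f \<Longrightarrow> tensor_lift f (tensor_flip t) = tensor_lift (\<lambda>a b. f b a) t"
  by (simp add: tensor_flip_def tensor_lift_lift lift_tensor)

lemma tensor_lift_assoc:
  assumes "\<And>b c. clinear (\<lambda>a. f a b c)" "\<And>a c. clinear (\<lambda>b. f a b c)"
    "\<And>a b. clinear (\<lambda>c. f a b c)"
  shows "tensor_lift (\<lambda>a t. tensor_lift (f a) t) (tensor_assoc u)
    = tensor_lift (\<lambda>t c. tensor_lift (\<lambda>a b. f a b c) t) u"
proof -
  have "cbilinear (f a)" for a by (intro lin assms)
  moreover from this have "cbilinear (\<lambda>a t. tensor_lift (f a) t)"
    by (intro lin assms)
  ultimately show ?thesis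
    by (simp add: tensor_assoc_def tensor_lift_lift lift_tensor)
qed

lemma tensor_lift_tensor_left: "tensor_lift f t \<otimes> c = tensor_lift (\<lambda>a b. f a b \<otimes> c) t"
  by (rule clinear_tensor_lift[where g = "\<lambda>x. x \<otimes> c"]) (intro lin)

lemma tensor_lift_tensor_right: "c \<otimes> tensor_lift f t = tensor_lift (\<lambda>a b. c \<otimes> f a b) t"
  by (rule clinear_tensor_lift[where g = "\<lambda>x. c \<otimes> x"]) (intro lin)

lemma tensor_lift_times_left: "tensor_lift f t * c = tensor_lift (\<lambda>a b. f a b * c :: complex) t"
  by (rule clinear_tensor_lift[where g = "\<lambda>x. x * c"]) (intro lin)

lemma tensor_lift_times_right: "c * tensor_lift f t = tensor_lift (\<lambda>a b. c * f a b :: complex) t"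
  by (rule clinear_tensor_lift[where g = "\<lambda>x. c * x"]) (intro lin)

lemma cbilinear_left: "cbilinear f \<Longrightarrow> clinear g \<Longrightarrow> clinear (\<lambda>x. f (g x) c)"
  by (rule clinear_compose[where g = "\<lambda>x. f x c"]) (simp_all add: cbilinear_def)

lemma cbilinear_right: "cbilinear f \<Longrightarrow> clinear g \<Longrightarrow> clinear (\<lambda>x. f c (g x))"
  by (rule clinear_compose[where g = "\<lambda>x. f c x"]) (simp_all add: cbilinear_def)

lemma clinear_inv:
  assumes "clinear f" "bij f"
  shows "clinear (inv f)"
proof -
  have "inv f (x + y) = inv f x + inv f y" "inv f (c *\<^sub>C x) = c *\<^sub>C inv f x" for x y c
    using assms by (auto intro!: inv_f_eq bij_is_inj simp: clinear_iff surj_f_inv_f bij_is_surj)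
  then show ?thesis by (simp add: clinear_iff)
qed

section \<open>Sweedler calculus\<close>

context cx_algebra
begin

lemma lin_mult_left [lin]: "clinear f \<Longrightarrow> clinear (\<lambda>x. mult (f x) c)"
  by (rule clinear_compose[OF clinear_mult_left])

lemma lin_mult_right [lin]: "clinear f \<Longrightarrow> clinear (\<lambda>x. mult c (f x))"
  by (rule clinear_compose[OF clinear_mult_right])

lemma mult_scaleC_left [simp]: "mult (c *\<^sub>C a) b = c *\<^sub>C mult a b"
  by (rule clinear_scale[OF clinear_mult_left])

lemma mult_scaleC_right [simp]: "mult a (c *\<^sub>C b) = c *\<^sub>C mult a b"
  by (rule clinear_scale[OF clinear_mult_right])

lemma mult_lift_left: "mult (tensor_lift f t) c = tensor_lift (\<lambda>a b. mult (f a b) c) t"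
  by (rule clinear_tensor_lift[OF clinear_mult_left])

lemma mult_lift_right: "mult c (tensor_lift f t) = tensor_lift (\<lambda>a b. mult c (f a b)) t"
  by (rule clinear_tensor_lift[OF clinear_mult_right])

lemma tensor_mult_tensor [simp]:
  "tensor_mult mult (a \<otimes> b) (c \<otimes> d) = mult a c \<otimes> mult b d"
  by (simp add: tensor_mult_def lift_tensor lin)

lemma lin_tensor_mult_left: "clinear f \<Longrightarrow> clinear (\<lambda>x. tensor_mult mult (f x) c)"
  unfolding tensor_mult_def by (intro lin)

lemma lin_tensor_mult_right: "clinear f \<Longrightarrow> clinear (\<lambda>x. tensor_mult mult c (f x))"
  unfolding tensor_mult_def by (intro lin)

text \<open>Makes the tensor square a target for convolution, as used in
  \<open>comult_antipode\<close>.\<close>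

lemma tensor_algebra: "cx_algebra (tensor_mult mult) (one \<otimes> one)"
proof (rule cx_algebra.intro)
  note rules = lin lin_tensor_mult_left lin_tensor_mult_right
  let ?m = "tensor_mult mult"
  show "clinear (\<lambda>a. ?m a b)" for b by (intro rules)
  show "clinear (?m a)" for a by (intro rules)
  show "?m (one \<otimes> one) t = t" for t
    by (rule clinear_eq_tensor[where f = "?m (one \<otimes> one)" and g = "\<lambda>t. t"])
      (intro rules | simp add: mult_one_left)+
  show "?m t (one \<otimes> one) = t" for t
    by (rule clinear_eq_tensor[where f = "\<lambda>t. ?m t (one \<otimes> one)" and g = "\<lambda>t. t"])
      (intro rules | simp add: mult_one_right)+
  \<comment> \<open>Associativity is reduced to elementary tensors one argument at a time, beginning
    with the last.\<close>
  have 1: "?m (?m (a \<otimes> a') (b \<otimes> b')) t = ?m (a \<otimes> a') (?m (b \<otimes> b') t)"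
    for a a' b b' t
    by (rule clinear_eq_tensor[where f = "?m (?m (a \<otimes> a') (b \<otimes> b'))"
          and g = "\<lambda>t. ?m (a \<otimes> a') (?m (b \<otimes> b') t)"])
      (intro rules | simp add: mult_assoc)+
  have 2: "?m (?m (a \<otimes> a') s) t = ?m (a \<otimes> a') (?m s t)" for a a' s t
    by (rule clinear_eq_tensor[where f = "\<lambda>s. ?m (?m (a \<otimes> a') s) t"
          and g = "\<lambda>s. ?m (a \<otimes> a') (?m s t)"])
      (intro rules | rule 1)+
  show "?m (?m r s) t = ?m r (?m s t)" for r s t
    by (rule clinear_eq_tensor[where f = "\<lambda>r. ?m (?m r s) t" and g = "\<lambda>r. ?m r (?m s t)"])
      (intro rules | rule 2)+
qed

end

context cx_coalgebra
begin

text \<open>In \<open>sw h f\<close> the sum \<open>f h\<^sub>1 h\<^sub>2\<close> of Sweedler notation is taken over the representative of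
  \<open>comult h\<close> chosen by the quotient type. Linear maps can therefore be pulled out and iterated
  sums exchanged for arbitrary \<open>f\<close>; multilinearity is needed only for rules that replace
  the tensor by an equal one.\<close>

abbreviation sw :: "'h \<Rightarrow> ('h \<Rightarrow> 'h \<Rightarrow> 'b::complex_vector) \<Rightarrow> 'b"
  where "sw h f \<equiv> tensor_lift f (comult h)"

lemma lin_comult [lin]: "clinear f \<Longrightarrow> clinear (\<lambda>x. comult (f x))"
  by (rule clinear_compose[OF clinear_comult])

lemma lin_counit [lin]: "clinear f \<Longrightarrow> clinear (\<lambda>x. counit (f x))"
  by (rule clinear_compose[OF clinear_counit])

lemma sw_coassoc:
  assumes "\<And>b c. clinear (\<lambda>a. f a b c)" "\<And>a c. clinear (\<lambda>b. f a b c)"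
    "\<And>a b. clinear (\<lambda>c. f a b c)"
  shows "sw h (\<lambda>a b. sw a (\<lambda>c d. f c d b)) = sw h (\<lambda>a b. sw b (\<lambda>c d. f a c d))"
  using tensor_lift_assoc[of f "tensor_map comult id (comult h)", OF assms]
  by (simp add: coassoc tensor_lift_map lin assms)

lemma sw_counit_left: "clinear g \<Longrightarrow> sw h (\<lambda>a b. counit a *\<^sub>C g b) = g h"
  using clinear_tensor_lift[of g "\<lambda>a b. counit a *\<^sub>C b" "comult h"]
  by (simp add: counit_left clinear_scale)

lemma sw_counit_right: "clinear g \<Longrightarrow> sw h (\<lambda>a b. counit b *\<^sub>C g a) = g h"
  using clinear_tensor_lift[of g "\<lambda>a b. counit b *\<^sub>C a" "comult h"]
  by (simp add: counit_right clinear_scale)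

text \<open>A left inverse \<open>f\<close> and a right inverse \<open>k\<close> of \<open>g\<close>
  under convolution agree: bracket the product of \<open>f\<close>, \<open>g\<close> and
  \<open>k\<close> in two ways.\<close>

lemma convolution_inverse_unique:
  fixes m :: "'a::complex_vector \<Rightarrow> 'a \<Rightarrow> 'a"
  assumes "cx_algebra m e" and lin': "clinear f" "clinear g" "clinear k"
    and fg: "\<And>h. sw h (\<lambda>a b. m (f a) (g b)) = counit h *\<^sub>C e"
    and gk: "\<And>h. sw h (\<lambda>a b. m (g a) (k b)) = counit h *\<^sub>C e"
  shows "f h = k h"
proof -
  interpret A: cx_algebra m e by fact
  note rules = A.lin_mult_left A.lin_mult_right lin lin'[THEN clinear_compose]
  have "k h = sw h (\<lambda>a b. m (sw a (\<lambda>c d. m (f c) (g d))) (k b))"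
    by (simp add: fg A.mult_one_left sw_counit_left lin')
  also have "\<dots> = sw h (\<lambda>a b. sw a (\<lambda>c d. m (f c) (m (g d) (k b))))"
    by (simp add: A.mult_lift_left A.mult_assoc)
  also have "\<dots> = sw h (\<lambda>a b. sw b (\<lambda>c d. m (f a) (m (g c) (k d))))"
    by (rule sw_coassoc) (intro rules)+
  also have "\<dots> = sw h (\<lambda>a b. m (f a) (sw b (\<lambda>c d. m (g c) (k d))))"
    by (simp add: A.mult_lift_right)
  also have "\<dots> = f h"
    by (simp add: gk A.mult_one_right sw_counit_right lin')
  finally show ?thesis ..
qed

end

context hopf_algebra
begin

lemma lin_antipode [lin]: "clinear f \<Longrightarrow> clinear (\<lambda>x. antipode (f x))"
  by (rule clinear_compose[OF clinear_antipode])

lemma cbilinear_mult: "cbilinear mult"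
  by (intro lin)

lemma sw_antipode_left:
  assumes "clinear g"
  shows "sw h (\<lambda>a b. g (mult (antipode a) b)) = counit h *\<^sub>C g one"
  using antipode_left[of h] clinear_tensor_lift[OF assms, of "\<lambda>a b. mult (antipode a) b" "comult h"]
  by (simp add: tensor_lift_map cbilinear_mult clinear_scale assms)

lemma sw_antipode_right:
  assumes "clinear g"
  shows "sw h (\<lambda>a b. g (mult a (antipode b))) = counit h *\<^sub>C g one"
  using antipode_right[of h] clinear_tensor_lift[OF assms, of "\<lambda>a b. mult a (antipode b)" "comult h"]
  by (simp add: tensor_lift_map cbilinear_mult clinear_scale assms)

lemma lift_comult_mult:
  "cbilinear f \<Longrightarrow>
    sw (mult x y) f = sw x (\<lambda>a b. sw y (\<lambda>c d. f (mult a c) (mult b d)))"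
  by (simp add: comult_mult tensor_mult_def tensor_lift_lift lift_tensor)

section \<open>Standard identities for the antipode\<close>

lemma antipode_one: "antipode one = one"
  using antipode_left[of one]
  by (simp add: comult_one tensor_lift_map cbilinear_mult lift_tensor lin mult_one_right
      counit_one scaleC_one)

lemma counit_antipode: "counit (antipode h) = counit h"
proof -
  have "counit (antipode h) = sw h (\<lambda>a b. counit b *\<^sub>C counit (antipode a))"
    by (rule sw_counit_right[symmetric]) (intro lin)
  also have "\<dots> = sw h (\<lambda>a b. counit (mult (antipode a) b))"
    by (simp add: counit_mult scaleC_complex_def mult.commute)
  also have "\<dots> = counit h *\<^sub>C counit one"
    by (rule sw_antipode_left) (intro lin)
  finally show ?thesis by (simp add: counit_one scaleC_complex_def)
qed

text \<open>Both sides equal \<open>S (x\<^sub>1 y\<^sub>1) x\<^sub>2 y\<^sub>2 S y\<^sub>3 S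
  x\<^sub>3\<close>: cancelling from the left gives \<open>S y S x\<close>, from the inside
  \<open>S (x y)\<close>.\<close>

lemma antipode_mult: "antipode (mult x y) = mult (antipode y) (antipode x)"
proof -
  let ?S = antipode
  \<comment> \<open>Cancels \<open>y\<^sub>2 S y\<^sub>3\<close>; here \<open>c\<close>,
    \<open>d\<close>, \<open>e\<close> stand for \<open>x\<^sub>1\<close>, \<open>x\<^sub>2\<close>,
    \<open>S x\<^sub>3\<close>.\<close>
  have inner: "sw y (\<lambda>a b. sw a (\<lambda>p q. mult (?S (mult c p)) (mult (mult d q) (mult (?S b) e))))
      = mult (?S (mult c y)) (mult d e)" for c d e
  proof -
    have "sw y (\<lambda>a b. sw a (\<lambda>p q. mult (?S (mult c p)) (mult (mult d q) (mult (?S b) e))))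
        = sw y (\<lambda>a b. sw b (\<lambda>p q. mult (?S (mult c a)) (mult (mult d p) (mult (?S q) e))))"
      by (rule sw_coassoc) (intro lin)+
    also have "\<dots> = sw y (\<lambda>a b. sw b (\<lambda>p q.
        mult (?S (mult c a)) (mult d (mult (mult p (?S q)) e))))"
      by (simp add: mult_assoc)
    also have "\<dots> = sw y (\<lambda>a b. counit b *\<^sub>C mult (?S (mult c a)) (mult d (mult one e)))"
      by (subst sw_antipode_right) (intro lin, rule refl)
    also have "\<dots> = mult (?S (mult c y)) (mult d (mult one e))"
      by (rule sw_counit_right) (intro lin)
    finally show ?thesis by (simp add: mult_one_left)
  qed
  have "mult (?S y) (?S x)
      = sw x (\<lambda>a b. counit a *\<^sub>C sw y (\<lambda>c d. counit c *\<^sub>C mult (?S d) (?S b)))"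
    by (simp add: sw_counit_left lin)
  also have "\<dots> = sw x (\<lambda>a b. sw y (\<lambda>c d. counit (mult a c) *\<^sub>C mult (?S d) (?S b)))"
    by (simp add: tensor_lift_scaleC_right scaleC_scaleC counit_mult)
  also have "\<dots> = sw x (\<lambda>a b. sw y (\<lambda>c d.
      sw (mult a c) (\<lambda>p q. mult (mult (?S p) q) (mult (?S d) (?S b)))))"
    by (subst sw_antipode_left) (intro lin, simp add: mult_one_left)
  also have "\<dots> = sw x (\<lambda>a b. sw y (\<lambda>c d. sw a (\<lambda>r s. sw c (\<lambda>p q.
      mult (?S (mult r p)) (mult (mult s q) (mult (?S d) (?S b)))))))"
    by (simp add: lift_comult_mult lin mult_assoc)
  also have "\<dots> = sw x (\<lambda>a b. sw a (\<lambda>r s. sw y (\<lambda>c d. sw c (\<lambda>p q.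
      mult (?S (mult r p)) (mult (mult s q) (mult (?S d) (?S b)))))))"
    by (subst tensor_lift_swap) (rule refl)
  also have "\<dots> = sw x (\<lambda>a b. sw a (\<lambda>r s. mult (?S (mult r y)) (mult s (?S b))))"
    by (simp add: inner)
  also have "\<dots> = sw x (\<lambda>a b. sw b (\<lambda>r s. mult (?S (mult a y)) (mult r (?S s))))"
    by (rule sw_coassoc) (intro lin)+
  also have "\<dots> = sw x (\<lambda>a b. counit b *\<^sub>C ?S (mult a y))"
    by (subst sw_antipode_right) (intro lin, simp add: mult_one_right)
  also have "\<dots> = ?S (mult x y)"
    by (rule sw_counit_right) (intro lin)
  finally show ?thesis ..
qed

text \<open>As maps into the tensor square, the left side is a left and the right side a right
  convolution inverse of \<open>comult\<close>.\<close>

lemma comult_antipode: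
  "comult (antipode h) = sw h (\<lambda>a b. antipode b \<otimes> antipode a)"
proof (rule convolution_inverse_unique[OF tensor_algebra, where g = comult])
  let ?m = "tensor_mult mult" and ?S = antipode
  note rules = lin lin_tensor_mult_left lin_tensor_mult_right
  interpret T: cx_algebra ?m "one \<otimes> one" by (rule tensor_algebra)
  show "clinear (\<lambda>h. comult (?S h))" "clinear comult"
    "clinear (\<lambda>h. sw h (\<lambda>a b. ?S b \<otimes> ?S a))"
    by (intro lin)+
  fix h
  have "sw h (\<lambda>a b. ?m (comult (?S a)) (comult b)) = sw h (\<lambda>a b. comult (mult (?S a) b))"
    by (simp add: comult_mult)
  also have "\<dots> = counit h *\<^sub>C (one \<otimes> one)"
    by (subst sw_antipode_left) (intro lin, simp add: comult_one)
  finally show "sw h (\<lambda>a b. ?m (comult (?S a)) (comult b)) = counit h *\<^sub>C (one \<otimes> one)" .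
  \<comment> \<open>Rebrackets the last three of four legs so that
    \<open>h\<^sub>2 S h\<^sub>3\<close> stands together and cancels.\<close>
  have coassoc': "sw b (\<lambda>p q. sw q (\<lambda>c d. mult a (?S d) \<otimes> mult p (?S c)))
      = sw b (\<lambda>p q. sw p (\<lambda>c d. mult a (?S q) \<otimes> mult c (?S d)))" for a b
    by (rule sw_coassoc[symmetric]) (intro lin)+
  have "sw h (\<lambda>a b. ?m (comult a) (sw b (\<lambda>c d. ?S d \<otimes> ?S c)))
      = sw h (\<lambda>a b. sw a (\<lambda>p q. sw b (\<lambda>c d. mult p (?S d) \<otimes> mult q (?S c))))"
    by (simp add: tensor_mult_def tensor_lift_lift lift_tensor rules)
  also have "\<dots> = sw h (\<lambda>a b. sw b (\<lambda>p q. sw q (\<lambda>c d. mult a (?S d) \<otimes> mult p (?S c))))"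
    by (rule sw_coassoc) (intro lin)+
  also have "\<dots> = sw h (\<lambda>a b. sw b (\<lambda>p q. sw p (\<lambda>c d. mult a (?S q) \<otimes> mult c (?S d))))"
    by (subst coassoc') (rule refl)
  also have "\<dots> = sw h (\<lambda>a b. sw b (\<lambda>p q. counit p *\<^sub>C (mult a (?S q) \<otimes> one)))"
    by (subst sw_antipode_right) (intro lin, rule refl)
  also have "\<dots> = sw h (\<lambda>a b. mult a (?S b) \<otimes> one)"
    by (subst sw_counit_left) (intro lin, rule refl)
  also have "\<dots> = counit h *\<^sub>C (one \<otimes> one)"
    by (rule sw_antipode_right) (intro lin)
  finally show "sw h (\<lambda>a b. ?m (comult a) (sw b (\<lambda>c d. ?S d \<otimes> ?S c)))
    = counit h *\<^sub>C (one \<otimes> one)" .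
qed

lemma lift_comult_antipode:
  "cbilinear f \<Longrightarrow> sw (antipode h) f = sw h (\<lambda>a b. f (antipode b) (antipode a))"
  by (simp add: comult_antipode tensor_lift_lift lift_tensor)

end

section \<open>Hopf algebras with integrals\<close>

locale hopf_integrals = hopf_algebra mult one comult counit antipode
  for mult :: "'h::complex_vector \<Rightarrow> 'h \<Rightarrow> 'h" and one :: 'h
    and comult :: "'h \<Rightarrow> ('h, 'h) tensor" and counit :: "'h \<Rightarrow> complex"
    and antipode :: "'h \<Rightarrow> 'h" +
  fixes integ :: "'h \<Rightarrow> complex" and \<Lambda> :: 'h
  assumes clinear_integ: "clinear integ"
    and integ_invariant: "sw h (\<lambda>a b. integ a *\<^sub>C b) = integ h *\<^sub>C one"
    and mult_integral: "mult h \<Lambda> = counit h *\<^sub>C \<Lambda>"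
    and integ_integral: "integ \<Lambda> = 1"
begin

section \<open>Identities for the integral and the integral element\<close>

lemma lin_integ [lin]: "clinear f \<Longrightarrow> clinear (\<lambda>x. integ (f x))"
  by (rule clinear_compose[OF clinear_integ])

lemma integ_scaleC [simp]: "integ (c *\<^sub>C x) = c * integ x"
  using clinear_scale[OF clinear_integ] by (simp add: scaleC_complex_def)

lemma integ_lift: "integ (tensor_lift f t) = tensor_lift (\<lambda>a b. integ (f a b)) t"
  by (rule clinear_tensor_lift[OF clinear_integ])

lemma antipode_scaleC [simp]: "antipode (c *\<^sub>C x) = c *\<^sub>C antipode x"
  by (rule clinear_scale[OF clinear_antipode])

lemma antipode_lift: "antipode (tensor_lift f t) = tensor_lift (\<lambda>a b. antipode (f a b)) t"
  by (rule clinear_tensor_lift[OF clinear_antipode])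

text \<open>Invariance at \<open>x h\<^sub>1\<close> turns the right side into
  \<open>\<integral>(x\<^sub>1 h\<^sub>1) x\<^sub>2 h\<^sub>2 S h\<^sub>3\<close>, whose last two
  factors cancel.\<close>

lemma integ_shift:
  "sw x (\<lambda>a b. integ (mult a h) *\<^sub>C b) = sw h (\<lambda>a b. integ (mult x a) *\<^sub>C antipode b)"
proof -
  have "sw h (\<lambda>a b. integ (mult x a) *\<^sub>C antipode b)
      = sw h (\<lambda>a b. mult (sw (mult x a) (\<lambda>c d. integ c *\<^sub>C d)) (antipode b))"
    by (simp add: integ_invariant mult_one_left)
  also have "\<dots> = sw h (\<lambda>a b. sw x (\<lambda>p q. sw a (\<lambda>r s.
      integ (mult p r) *\<^sub>C mult (mult q s) (antipode b))))"
    by (simp add: lift_comult_mult lin mult_lift_left)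
  also have "\<dots> = sw x (\<lambda>p q. sw h (\<lambda>a b. sw a (\<lambda>r s.
      integ (mult p r) *\<^sub>C mult q (mult s (antipode b)))))"
    by (subst tensor_lift_swap) (simp add: mult_assoc)
  also have "\<dots> = sw x (\<lambda>p q. sw h (\<lambda>r b. sw b (\<lambda>s t.
      integ (mult p r) *\<^sub>C mult q (mult s (antipode t)))))"
    by (subst sw_coassoc) ((intro lin)+, rule refl)
  also have "\<dots> = sw x (\<lambda>p q. sw h (\<lambda>r b. counit b *\<^sub>C (integ (mult p r) *\<^sub>C mult q one)))"
    by (subst sw_antipode_right) (intro lin, rule refl)
  also have "\<dots> = sw x (\<lambda>p q. integ (mult p h) *\<^sub>C mult q one)"
    by (subst sw_counit_right) (intro lin, rule refl)
  finally show ?thesis by (simp add: mult_one_right)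
qed

text \<open>This is \<open>integ_shift\<close> at \<Lambda>, where multiplication by
  \<open>x\<^sub>1\<close> reduces to its counit.\<close>

lemma integ_expansion: "sw \<Lambda> (\<lambda>a b. integ (mult x a) *\<^sub>C antipode b) = x"
  using integ_shift[where x = x and h = \<Lambda>] counit_left[of x] by (simp add: mult_integral integ_integral)

lemma surj_antipode: "surj antipode"
proof
  have "antipode (sw \<Lambda> (\<lambda>a b. integ (mult x a) *\<^sub>C b)) = x" for x
    by (simp add: antipode_lift integ_expansion)
  then show "UNIV \<subseteq> range antipode" by (metis rangeI subsetI)
qed simp

text \<open>Insert \<open>\<epsilon>(h\<^sub>1) \<Lambda> = h\<^sub>1 \<Lambda>\<close> into the
  right side; the antipode reverses the product in the second leg, where
  \<open>S h\<^sub>2 h\<^sub>3\<close> then cancels.\<close>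

lemma comult_integral_exchange:
  assumes f: "cbilinear f"
  shows "sw \<Lambda> (\<lambda>a b. f (mult h a) (antipode b)) = sw \<Lambda> (\<lambda>a b. f a (mult (antipode b) h))"
proof -
  note rules = lin cbilinear_left[OF f] cbilinear_right[OF f]
  have "sw \<Lambda> (\<lambda>a b. f a (mult (antipode b) h))
      = sw h (\<lambda>p q. counit p *\<^sub>C sw \<Lambda> (\<lambda>a b. f a (mult (antipode b) q)))"
    by (rule sw_counit_left[symmetric]) (intro rules)
  also have "\<dots> = sw h (\<lambda>p q. sw (mult p \<Lambda>) (\<lambda>a b. f a (mult (antipode b) q)))"
  proof -
    have "sw (c *\<^sub>C \<Lambda>) (\<lambda>a b. f a (mult (antipode b) q))
      = c *\<^sub>C sw \<Lambda> (\<lambda>a b. f a (mult (antipode b) q))" for c q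
      by (rule clinear_scale[where f = "\<lambda>h. sw h (\<lambda>a b. f a (mult (antipode b) q))"])
        (intro rules)
    then show ?thesis by (simp add: mult_integral)
  qed
  also have "\<dots> = sw h (\<lambda>p q. sw p (\<lambda>r s. sw \<Lambda> (\<lambda>a b.
      f (mult r a) (mult (antipode b) (mult (antipode s) q)))))"
    by (simp add: lift_comult_mult rules antipode_mult mult_assoc)
  also have "\<dots> = sw h (\<lambda>r q. sw q (\<lambda>s t. sw \<Lambda> (\<lambda>a b.
      f (mult r a) (mult (antipode b) (mult (antipode s) t)))))"
    by (rule sw_coassoc) (intro rules)+
  also have "\<dots> = sw h (\<lambda>r q. counit q *\<^sub>C sw \<Lambda> (\<lambda>a b.
      f (mult r a) (mult (antipode b) one)))"
    by (subst sw_antipode_left) (intro rules, rule refl)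
  also have "\<dots> = sw \<Lambda> (\<lambda>a b. f (mult h a) (mult (antipode b) one))"
    by (rule sw_counit_right) (intro rules)
  finally show ?thesis by (simp add: mult_one_right)
qed

section \<open>The associated operations and their pairing with the integral\<close>

abbreviation dmult :: "'h \<Rightarrow> 'h \<Rightarrow> 'h"  (infixl \<open>\<bullet>\<close> 70)
  where "dmult \<equiv> assoc_mult mult comult antipode integ"

abbreviation dcomult :: "'h \<Rightarrow> ('h, 'h) tensor"
  where "dcomult \<equiv> assoc_comult mult comult antipode \<Lambda>"

abbreviation dantipode :: "'h \<Rightarrow> 'h"
  where "dantipode \<equiv> assoc_antipode mult comult integ \<Lambda>"

lemma dcomult_eq: "dcomult h = sw \<Lambda> (\<lambda>a b. a \<otimes> mult (antipode b) h)"
  by (simp add: assoc_comult_def tensor_map_def)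

lemma dcomult_eq': "dcomult h = sw \<Lambda> (\<lambda>a b. mult h a \<otimes> antipode b)"
  unfolding dcomult_eq by (rule comult_integral_exchange[symmetric]) (intro lin)

lemma lin_dmult_left [lin]: "clinear f \<Longrightarrow> clinear (\<lambda>x. f x \<bullet> k)"
  unfolding assoc_mult_def by (intro lin)

lemma lin_dmult_right [lin]: "clinear f \<Longrightarrow> clinear (\<lambda>x. h \<bullet> f x)"
  unfolding assoc_mult_def by (intro lin)

lemma lin_dcomult [lin]: "clinear f \<Longrightarrow> clinear (\<lambda>x. dcomult (f x))"
  unfolding dcomult_eq by (intro lin)

lemma lin_dantipode [lin]: "clinear f \<Longrightarrow> clinear (\<lambda>x. dantipode (f x))"
  unfolding assoc_antipode_def by (intro lin)

text \<open>\<open>integ_shift\<close> moves the splitting from \<open>h\<close> to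
  \<open>x\<close>, which exhibits the product as convolution of functionals.\<close>

lemma integ_dmult:
  "integ (mult x (h \<bullet> k)) = sw x (\<lambda>a b. integ (mult a h) * integ (mult b k))"
proof -
  have "integ (mult x (h \<bullet> k))
      = integ (mult (sw h (\<lambda>a b. integ (mult x a) *\<^sub>C antipode b)) k)"
    by (simp add: assoc_mult_def mult_lift_left mult_lift_right integ_lift mult.commute)
  also have "\<dots> = sw x (\<lambda>a b. integ (mult a h) * integ (mult b k))"
    unfolding integ_shift[symmetric] by (simp add: mult_lift_left integ_lift)
  finally show ?thesis .
qed

text \<open>\<open>integ_expansion\<close> reassembles \<open>x\<close> from the legs of \<Lambda>,
  to the right of \<open>y\<close>; hence the opposite product.\<close>

lemma integ_dcomult:
  "tensor_lift (\<lambda>a b. integ (mult x a) * integ (mult y b)) (dcomult h)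
    = integ (mult (mult y x) h)"
proof -
  have "tensor_lift (\<lambda>a b. integ (mult x a) * integ (mult y b)) (dcomult h)
      = integ (mult (mult y (sw \<Lambda> (\<lambda>a b. integ (mult x a) *\<^sub>C antipode b))) h)"
    by (simp add: dcomult_eq tensor_lift_lift lift_tensor lin mult_lift_left mult_lift_right
        integ_lift mult_assoc)
  then show ?thesis by (simp add: integ_expansion)
qed

end

text \<open>Finite dimension enters through this assumption, since a surjective antipode is then
  injective.\<close>

locale hopf_integrals_inj = hopf_integrals +
  assumes inj_antipode: "inj antipode"
begin

section \<open>Nondegeneracy of the pairing\<close>

lemma bij_antipode: "bij antipode"
  by (simp add: bij_def inj_antipode surj_antipode)

text \<open>The antipode swaps the legs, so applying it reduces the claim to right invariance at
  \<open>antipode h\<close>.\<close>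

lemma integ_antipode_invariant:
  "sw h (\<lambda>a b. integ (antipode b) *\<^sub>C a) = integ (antipode h) *\<^sub>C one"
proof (rule injD[OF inj_antipode])
  have "antipode (sw h (\<lambda>a b. integ (antipode b) *\<^sub>C a))
      = sw (antipode h) (\<lambda>a b. integ a *\<^sub>C b)"
    by (simp add: antipode_lift lift_comult_antipode lin)
  then show "antipode (sw h (\<lambda>a b. integ (antipode b) *\<^sub>C a))
      = antipode (integ (antipode h) *\<^sub>C one)"
    by (simp add: integ_invariant antipode_one)
qed

text \<open>\<open>comult_integral_exchange\<close> turns \<open>h\<close> into a left factor of the
  first leg; the rest is \<open>integ_antipode_invariant\<close> at \<Lambda>.\<close>

lemma integ_antipode_exchange:
  "sw \<Lambda> (\<lambda>a b. integ (mult (antipode b) h) *\<^sub>C a) = integ (antipode \<Lambda>) *\<^sub>C h"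
proof -
  have "sw \<Lambda> (\<lambda>a b. integ (mult (antipode b) h) *\<^sub>C a)
      = mult h (sw \<Lambda> (\<lambda>a b. integ (antipode b) *\<^sub>C a))"
    using comult_integral_exchange[of "\<lambda>a b. integ b *\<^sub>C a" h]
    by (simp add: lin mult_lift_right)
  then show ?thesis by (simp add: integ_antipode_invariant mult_one_right)
qed

text \<open>At \<Lambda> the left side of the exchange formula collapses to \<Lambda>, so \<Lambda>
  is \<open>integ (antipode \<Lambda>)\<close> times itself; now integrate.\<close>

lemma integ_antipode_integral: "integ (antipode \<Lambda>) = 1"
  using integ_antipode_exchange[of \<Lambda>] counit_right[of \<Lambda>]
  by (simp add: mult_integral integ_integral counit_antipode)
    (metis integ_integral integ_scaleC mult.right_neutral)

lemma integ_reconstruct: "sw \<Lambda> (\<lambda>a b. integ (mult (antipode b) h) *\<^sub>C a) = h"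
  by (simp add: integ_antipode_exchange integ_antipode_integral scaleC_one)

lemma integ_eqI:
  assumes "\<And>x. integ (mult x h) = integ (mult x k)"
  shows "h = k"
  by (subst integ_reconstruct[of h, symmetric], subst integ_reconstruct[of k, symmetric])
    (simp only: assms)

text \<open>\<open>integ_reconstruct\<close> in each leg. The coefficients see \<open>t\<close> only
  through its pairings, so pairings separate tensors.\<close>

lemma integ_tensor_reconstruct:
  "t = sw \<Lambda> (\<lambda>p q. sw \<Lambda> (\<lambda>r s.
    tensor_lift (\<lambda>a b. integ (mult (antipode q) a) * integ (mult (antipode s) b)) t *\<^sub>C (p \<otimes> r)))"
proof -
  have "t = tensor_lift (\<lambda>a b. sw \<Lambda> (\<lambda>p q. integ (mult (antipode q) a) *\<^sub>C p)
      \<otimes> sw \<Lambda> (\<lambda>r s. integ (mult (antipode s) b) *\<^sub>C r)) t"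
    by (simp add: integ_reconstruct tensor_lift_tensor_id)
  also have "\<dots> = tensor_lift (\<lambda>a b. sw \<Lambda> (\<lambda>p q. sw \<Lambda> (\<lambda>r s.
      (integ (mult (antipode q) a) * integ (mult (antipode s) b)) *\<^sub>C (p \<otimes> r)))) t"
    by (simp only: tensor_lift_tensor_left)
      (simp add: tensor_lift_tensor_right scaleC_tensor_left scaleC_tensor_right scaleC_scaleC
        mult.commute)
  also have "\<dots> = sw \<Lambda> (\<lambda>p q. tensor_lift (\<lambda>a b. sw \<Lambda> (\<lambda>r s.
      (integ (mult (antipode q) a) * integ (mult (antipode s) b)) *\<^sub>C (p \<otimes> r))) t)"
    by (rule tensor_lift_swap)
  also have "\<dots> = sw \<Lambda> (\<lambda>p q. sw \<Lambda> (\<lambda>r s. tensor_lift (\<lambda>a b.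
      (integ (mult (antipode q) a) * integ (mult (antipode s) b)) *\<^sub>C (p \<otimes> r)) t))"
    by (subst tensor_lift_swap) (rule refl)
  finally show ?thesis by (simp add: tensor_lift_scaleC_left)
qed

lemma integ_tensor_eqI:
  assumes "\<And>x y. tensor_lift (\<lambda>a b. integ (mult x a) * integ (mult y b)) s
    = tensor_lift (\<lambda>a b. integ (mult x a) * integ (mult y b)) t"
  shows "s = t"
  by (subst integ_tensor_reconstruct[of s], subst integ_tensor_reconstruct[of t])
    (simp add: assms)

text \<open>Injectivity strips the antipode from the expansion of \<open>antipode x\<close>, leaving
  \<open>x = \<integral>((S x) \<Lambda>\<^sub>1) \<Lambda>\<^sub>2\<close>; pairing this with
  \<open>h\<close> produces \<open>dantipode\<close>.\<close>

lemma integ_dantipode: "integ (mult (antipode x) (dantipode h)) = integ (mult x h)"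
proof -
  have "antipode (sw \<Lambda> (\<lambda>a b. integ (mult (antipode x) a) *\<^sub>C b)) = antipode x"
    by (simp add: antipode_lift integ_expansion)
  then have "sw \<Lambda> (\<lambda>a b. integ (mult (antipode x) a) *\<^sub>C b) = x"
    by (rule injD[OF inj_antipode])
  then have "integ (mult x h) = integ (mult (sw \<Lambda> (\<lambda>a b. integ (mult (antipode x) a) *\<^sub>C b)) h)"
    by simp
  also have "\<dots> = integ (mult (antipode x) (dantipode h))"
    by (simp add: assoc_antipode_def mult_lift_left mult_lift_right integ_lift mult.commute)
  finally show ?thesis ..
qed

section \<open>Hopf algebra axioms for the associated structure\<close>

lemma dual_algebra: "cx_algebra dmult \<Lambda>"
proof (rule cx_algebra.intro)
  show "clinear (\<lambda>a. a \<bullet> b)" for b by (intro lin)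
  show "clinear (dmult a)" for a by (intro lin)
  show "(a \<bullet> b) \<bullet> c = a \<bullet> (b \<bullet> c)" for a b c
  proof (rule integ_eqI)
    fix x
    \<comment> \<open>After pairing, associativity becomes coassociativity of
      \<open>comult\<close>.\<close>
    have "integ (mult x ((a \<bullet> b) \<bullet> c)) = sw x (\<lambda>p q. sw p (\<lambda>r s.
        integ (mult r a) * integ (mult s b) * integ (mult q c)))"
      by (simp add: integ_dmult tensor_lift_times_left)
    also have "\<dots> = sw x (\<lambda>r q. sw q (\<lambda>s t.
        integ (mult r a) * integ (mult s b) * integ (mult t c)))"
      by (rule sw_coassoc) (intro lin)+
    also have "\<dots> = integ (mult x (a \<bullet> (b \<bullet> c)))"
      by (simp add: integ_dmult tensor_lift_times_right mult.assoc)
    finally show "integ (mult x ((a \<bullet> b) \<bullet> c)) = integ (mult x (a \<bullet> (b \<bullet> c)))" .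
  qed
  show "\<Lambda> \<bullet> a = a" for a
    by (simp add: assoc_mult_def integ_reconstruct)
  show "a \<bullet> \<Lambda> = a" for a
    by (simp add: assoc_mult_def mult_integral integ_integral counit_antipode counit_right)
qed

lemma dual_coalgebra: "cx_coalgebra dcomult integ"
proof (rule cx_coalgebra.intro)
  show "clinear dcomult" "clinear integ" by (intro lin)+
  fix h
  \<comment> \<open>The two forms of \<open>dcomult\<close> are mixed so that, for two copies of
    \<Lambda>, both iterated coproducts become \<open>\<Lambda>'\<^sub>1 \<otimes> (S
    \<Lambda>'\<^sub>2) h \<Lambda>\<^sub>1 \<otimes> S \<Lambda>\<^sub>2\<close>.\<close>
  have "tensor_assoc (tensor_map dcomult id (dcomult h))
      = sw \<Lambda> (\<lambda>a b. sw \<Lambda> (\<lambda>c d. c \<otimes> (mult (antipode d) (mult h a) \<otimes> antipode b)))"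
    unfolding dcomult_eq'[of h]
    by (simp add: tensor_map_def tensor_assoc_def tensor_lift_lift lift_tensor lin dcomult_eq)
  also have "\<dots> = sw \<Lambda> (\<lambda>c d. sw \<Lambda> (\<lambda>a b. c \<otimes> (mult (antipode d) (mult h a) \<otimes> antipode b)))"
    by (rule tensor_lift_swap)
  also have "\<dots> = tensor_map id dcomult (dcomult h)"
    by (simp add: dcomult_eq[of h] dcomult_eq'[of "mult _ _"] tensor_map_def tensor_lift_lift
        lift_tensor lin mult_assoc tensor_lift_tensor_right)
  finally show "tensor_assoc (tensor_map dcomult id (dcomult h))
    = tensor_map id dcomult (dcomult h)" .
  have "tensor_lift (\<lambda>a b. integ a *\<^sub>C b) (dcomult h)
      = mult (antipode (sw \<Lambda> (\<lambda>a b. integ a *\<^sub>C b))) h"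
    by (simp add: dcomult_eq tensor_lift_lift lift_tensor lin antipode_lift mult_lift_left)
  then show "tensor_lift (\<lambda>a b. integ a *\<^sub>C b) (dcomult h) = h"
    by (simp add: integ_invariant integ_integral antipode_one mult_one_left scaleC_one)
  show "tensor_lift (\<lambda>a b. integ b *\<^sub>C a) (dcomult h) = h"
    by (simp add: dcomult_eq tensor_lift_lift lift_tensor lin integ_reconstruct)
qed

text \<open>Paired with \<open>x\<close> and \<open>y\<close>, this amounts to multiplicativity of
  \<open>comult\<close> on the product \<open>mult y x\<close>.\<close>

lemma dcomult_dmult: "dcomult (h \<bullet> k) = tensor_mult dmult (dcomult h) (dcomult k)"
proof (rule integ_tensor_eqI)
  fix x y
  let ?E = "\<lambda>r s p q a b c d. integ (mult r a) * integ (mult s c)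
      * (integ (mult p b) * integ (mult q d))"
  have "tensor_lift (\<lambda>a b. integ (mult x a) * integ (mult y b)) (dcomult (h \<bullet> k))
      = sw y (\<lambda>p q. sw x (\<lambda>r s. integ (mult (mult p r) h) * integ (mult (mult q s) k)))"
    by (simp add: integ_dcomult integ_dmult lift_comult_mult lin)
  \<comment> \<open>\<open>integ_dcomult\<close> is read backwards to express both integrals as
    pairings with \<open>dcomult h\<close> and \<open>dcomult k\<close>.\<close>
  also have "\<dots> = sw y (\<lambda>p q. sw x (\<lambda>r s.
      tensor_lift (\<lambda>a b. tensor_lift (\<lambda>c d. ?E r s p q a b c d) (dcomult k)) (dcomult h)))"
    by (simp only: integ_dcomult[symmetric] tensor_lift_times_left)
      (simp only: tensor_lift_times_right mult.assoc mult.left_commute)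
  also have "\<dots> = tensor_lift (\<lambda>a b. tensor_lift (\<lambda>c d.
      sw y (\<lambda>p q. sw x (\<lambda>r s. ?E r s p q a b c d))) (dcomult k)) (dcomult h)"
    by (simp only: tensor_lift_swap[of _ "dcomult h" "comult x"]
        tensor_lift_swap[of _ "dcomult k" "comult x"]
        tensor_lift_swap[of _ "dcomult h" "comult y"]
        tensor_lift_swap[of _ "dcomult k" "comult y"])
  also have "\<dots> = tensor_lift (\<lambda>a b. integ (mult x a) * integ (mult y b))
      (tensor_mult dmult (dcomult h) (dcomult k))"
    by (simp add: tensor_mult_def tensor_lift_lift lift_tensor lin integ_dmult,
        simp only: tensor_lift_times_right, simp only: tensor_lift_times_left)
  finally show "tensor_lift (\<lambda>a b. integ (mult x a) * integ (mult y b)) (dcomult (h \<bullet> k))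
    = tensor_lift (\<lambda>a b. integ (mult x a) * integ (mult y b))
        (tensor_mult dmult (dcomult h) (dcomult k))" .
qed

text \<open>Testing against \<open>antipode y\<close> suffices by surjectivity. There
  \<open>integ_dantipode\<close> removes \<open>dantipode\<close>, and the antipode law of the
  original algebra for \<open>S y\<^sub>1 y\<^sub>2\<close> remains.\<close>

lemma dantipode_left:
  "tensor_lift dmult (tensor_map dantipode id (dcomult h)) = integ h *\<^sub>C \<Lambda>"
proof (rule integ_eqI)
  fix x
  obtain y where x: "x = antipode y" using surj_antipode by blast
  have "integ (mult x (tensor_lift dmult (tensor_map dantipode id (dcomult h))))
      = tensor_lift (\<lambda>a b. sw y (\<lambda>p q. integ (mult q a) * integ (mult (antipode p) b))) (dcomult h)"
    by (simp add: x tensor_lift_map lin mult_lift_right integ_lift integ_dmult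
        lift_comult_antipode integ_dantipode)
  also have "\<dots> = sw y (\<lambda>p q. integ (mult (mult (antipode p) q) h))"
    by (subst tensor_lift_swap) (simp add: integ_dcomult)
  also have "\<dots> = counit y *\<^sub>C integ (mult one h)"
    by (rule sw_antipode_left) (intro lin)
  also have "\<dots> = integ (mult x (integ h *\<^sub>C \<Lambda>))"
    by (simp add: x mult_one_left mult_integral counit_antipode integ_integral scaleC_complex_def)
  finally show "integ (mult x (tensor_lift dmult (tensor_map dantipode id (dcomult h))))
    = integ (mult x (integ h *\<^sub>C \<Lambda>))" .
qed

lemma dantipode_right:
  "tensor_lift dmult (tensor_map id dantipode (dcomult h)) = integ h *\<^sub>C \<Lambda>"
proof (rule integ_eqI)
  fix x
  obtain y where x: "x = antipode y" using surj_antipode by blast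
  have "integ (mult x (tensor_lift dmult (tensor_map id dantipode (dcomult h))))
      = tensor_lift (\<lambda>a b. sw y (\<lambda>p q. integ (mult (antipode q) a) * integ (mult p b))) (dcomult h)"
    by (simp add: x tensor_lift_map lin mult_lift_right integ_lift integ_dmult
        lift_comult_antipode integ_dantipode)
  also have "\<dots> = sw y (\<lambda>p q. integ (mult (mult p (antipode q)) h))"
    by (subst tensor_lift_swap) (simp add: integ_dcomult)
  also have "\<dots> = counit y *\<^sub>C integ (mult one h)"
    by (rule sw_antipode_right) (intro lin)
  also have "\<dots> = integ (mult x (integ h *\<^sub>C \<Lambda>))"
    by (simp add: x mult_one_left mult_integral counit_antipode integ_integral scaleC_complex_def)
  finally show "integ (mult x (tensor_lift dmult (tensor_map id dantipode (dcomult h))))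
    = integ (mult x (integ h *\<^sub>C \<Lambda>))" .
qed

lemma dual_hopf_algebra: "hopf_algebra dmult \<Lambda> dcomult integ dantipode"
proof (rule hopf_algebra.intro[OF dual_algebra dual_coalgebra], rule hopf_algebra_axioms.intro)
  show "dcomult (a \<bullet> b) = tensor_mult dmult (dcomult a) (dcomult b)" for a b
    by (rule dcomult_dmult)
  \<comment> \<open>The factor \<open>(S \<Lambda>\<^sub>2) \<Lambda>\<close> is
    \<open>\<epsilon>(\<Lambda>\<^sub>2) \<Lambda>\<close>, so the counit law collapses the
    sum.\<close>
  show "dcomult \<Lambda> = \<Lambda> \<otimes> \<Lambda>"
    using clinear_tensor_lift[of "\<lambda>x. x \<otimes> \<Lambda>" "\<lambda>a b. counit b *\<^sub>C a" "comult \<Lambda>"]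
    by (simp add: dcomult_eq mult_integral counit_antipode scaleC_tensor_left scaleC_tensor_right
        counit_right lin)
  \<comment> \<open>This is the pairing formula at the unit, which is grouplike.\<close>
  show "integ (a \<bullet> b) = integ a * integ b" for a b
    using integ_dmult[of one a b] by (simp add: mult_one_left comult_one lift_tensor lin)
  show "integ \<Lambda> = 1" by (rule integ_integral)
  show "clinear dantipode" by (intro lin)
qed (rule dantipode_left dantipode_right)+

end

section \<open>The star operation of an antilinear automorphism\<close>

text \<open>The antipode reverses products and coproducts while \<theta> preserves them, so the
  composite reverses both. Most identities are checked after applying the injective
  antipode.\<close>

lemma (in hopf_algebra) flip_star_of_automorphism:
  assumes bij: "bij antipode" and anti: "antilinear \<theta>"
    and mult: "\<And>a b. \<theta> (mult a b) = mult (\<theta> a) (\<theta> b)" and one: "\<theta> one = one"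
    and comult: "\<And>h. comult (\<theta> h) = tensor_map \<theta> \<theta> (comult h)"
    and counit: "\<And>h. counit (\<theta> h) = cnj (counit h)"
    and antipode: "\<And>h. \<theta> (antipode h) = antipode (\<theta> h)"
    and square: "\<And>h. \<theta> (\<theta> h) = antipode (antipode h)"
  shows "flip_hopf_star_algebra mult one comult counit antipode (inv antipode \<circ> \<theta>)"
proof (rule flip_hopf_star_algebra.intro[OF hopf_algebra_axioms],
    rule flip_hopf_star_algebra_axioms.intro)
  let ?S = antipode and ?s = "inv antipode \<circ> \<theta>"
  have Ss [simp]: "?S (?s h) = \<theta> h" for h
    using bij by (simp add: surj_f_inv_f bij_is_surj)
  have invS [simp]: "inv ?S (?S h) = h" for h
    using bij by (simp add: bij_is_inj)
  have inj: "?S a = ?S b \<Longrightarrow> a = b" for a b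
    using bij by (metis bij_is_inj injD)
  have lin_inv: "clinear f \<Longrightarrow> clinear (\<lambda>x. inv ?S (f x))" for f :: "'h \<Rightarrow> 'h"
    by (rule clinear_compose[OF clinear_inv[OF clinear_antipode bij]])
  show "antilinear ?s"
    using anti clinear_inv[OF clinear_antipode bij] by (simp add: antilinear_def clinear_iff)
  show "?s (mult a b) = mult (?s b) (?s a)" for a b
    by (rule inj) (simp add: antipode_mult mult del: o_apply)
  show "?s one = one"
    by (rule inj) (simp add: one antipode_one del: o_apply)
  \<comment> \<open>Two antipodes turn the double star into \<open>\<theta> (\<theta> a)\<close>,
    which \<open>square\<close> identifies.\<close>
  show "?s (?s a) = a" for a
    by (rule inj, rule inj) (simp add: antipode[symmetric] square del: o_apply)
  show "cnj (counit h) = counit (?s h)" for h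
    using counit_antipode[of "?s h"] by (simp add: counit del: o_apply)
  show "?S (?s h) = ?s (?S h)" for h
    by (rule inj) (simp add: antipode del: o_apply)
  fix h
  note rules = lin lin_inv
  \<comment> \<open>The flipped inverse antipode on both legs is applied to
    \<open>comult (\<theta> h)\<close>, once through \<open>comult\<close> of the automorphism and
    once through \<open>comult\<close> of the antipode.\<close>
  have "tensor_lift (\<lambda>a b. inv ?S b \<otimes> inv ?S a) (comult (?S (?s h)))
      = tensor_lift (\<lambda>a b. inv ?S b \<otimes> inv ?S a) (tensor_map \<theta> \<theta> (comult h))"
    by (simp only: Ss comult)
  moreover have "tensor_lift (\<lambda>a b. inv ?S b \<otimes> inv ?S a) (comult (?S (?s h))) = comult (?s h)"
    by (simp add: lift_comult_antipode rules tensor_lift_tensor_id del: Ss o_apply)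
  ultimately show "comult (?s h) = tensor_flip (tensor_map ?s ?s (comult h))"
    by (simp add: tensor_lift_map rules tensor_flip_def del: Ss)
qed

theorem proposition3p6:
  fixes mult :: "'h::complex_vector \<Rightarrow> 'h \<Rightarrow> 'h" and one :: 'h
    and comult :: "'h \<Rightarrow> ('h, 'h) tensor" and counit :: "'h \<Rightarrow> complex"
    and S star :: "'h \<Rightarrow> 'h"
    and integ :: "'h \<Rightarrow> complex" and \<Lambda> :: 'h
  defines "S' \<equiv> assoc_antipode mult comult integ \<Lambda>"
  assumes "flip_hopf_star_algebra mult one comult counit S star"
    and "\<exists>B :: 'h set. finite_dimensional_vector_space scaleC B"
    and "right_invariant_integral one comult integ"
    and "left_integral_element mult counit \<Lambda>"
    and "integ \<Lambda> = 1"
    and "\<And>h. integ (star h) = cnj (integ (S h))"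
    and "star \<Lambda> = S \<Lambda>"
    and "S' \<circ> S' = S \<circ> S"
  shows "\<exists>star'.
    flip_hopf_star_algebra
      (assoc_mult mult comult S integ) \<Lambda>
      (assoc_comult mult comult S \<Lambda>) integ S' star' \<and>
    S' \<circ> star' = S \<circ> star"
proof -
  interpret H: flip_hopf_star_algebra mult one comult counit S star by (rule assms(2))
  have "hopf_integrals_axioms mult one comult counit integ \<Lambda>"
    using assms(4-6) unfolding right_invariant_integral_def left_integral_element_def
    by (intro hopf_integrals_axioms.intro) blast+
  then interpret H: hopf_integrals mult one comult counit S integ \<Lambda>
    by (rule hopf_integrals.intro[OF H.hopf_algebra_axioms])
  obtain B :: "'h set" where "finite_dimensional_vector_space scaleC B" using assms(3) ..
  then interpret F: finite_dimensional_vector_space scaleC B .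
  interpret H: hopf_integrals_inj mult one comult counit S integ \<Lambda>
    by (intro hopf_integrals_inj.intro hopf_integrals_inj_axioms.intro H.hopf_integrals_axioms
        F.linear_surj_imp_inj[OF H.clinear_antipode H.surj_antipode])
  interpret D: hopf_algebra "assoc_mult mult comult S integ" \<Lambda> "assoc_comult mult comult S \<Lambda>"
    integ S'
    unfolding S'_def by (rule H.dual_hopf_algebra)
  have square: "S' (S' h) = S (S h)" for h
    using assms(9) by (metis comp_apply)
  \<comment> \<open>\<open>S'\<close> is bijective because its square is the square of a
    bijection.\<close>
  have "bij (S \<circ> S)" using H.bij_antipode by (rule bij_comp) (rule H.bij_antipode)
  then have "bij (S' \<circ> S')" by (simp only: assms(9))
  then have "inj (S' \<circ> S')" "range (S' \<circ> S') = UNIV"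
    by (rule bij_is_inj, rule bij_is_surj)
  then have bij: "bij S'"
    unfolding image_comp[symmetric] by (intro bijI inj_on_imageI2[of S' S']) blast+
  define \<theta> where "\<theta> = S \<circ> star"
  have anti: "antilinear \<theta>"
    using H.antilinear_star H.clinear_antipode by (simp add: \<theta>_def antilinear_def clinear_iff)
  note additive = antilinear_additive[OF anti]
  have scale: "\<theta> (c *\<^sub>C h) = cnj c *\<^sub>C \<theta> h" for c h
    using anti by (simp add: antilinear_def)
  have mult: "\<theta> (mult a b) = mult (\<theta> a) (\<theta> b)" for a b
    by (simp add: \<theta>_def H.star_mult H.antipode_mult)
  have antipode: "\<theta> (S h) = S (\<theta> h)" for h
    by (simp add: \<theta>_def H.antipode_star)
  \<comment> \<open>Antilinearity in each argument conjugates the scalar on both sides, so this map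
    is balanced and its lift is additive though not linear.\<close>
  have balanced: "balanced (\<lambda>a b. \<theta> a \<otimes> \<theta> b)"
    using anti by (simp add: balanced_def antilinear_def tensor_add_left tensor_add_right
        scaleC_tensor_left scaleC_tensor_right)
  \<comment> \<open>The hypothesis on the integral, read at \<open>star h\<close>.\<close>
  have integ: "integ (\<theta> h) = cnj (integ h)" for h
    using assms(7)[of "star h"] by (simp add: \<theta>_def H.star_star)
  \<comment> \<open>The star commutes with the antipode, so \<theta> sends \<Lambda> to the star of
    \<open>S \<Lambda>\<close>, that is, to its double star.\<close>
  have \<Lambda>: "\<theta> \<Lambda> = \<Lambda>"
    by (metis H.antipode_star H.star_star \<theta>_def assms(8) comp_apply)
  \<comment> \<open>Star and antipode each flip the coproduct, and the two flips cancel.\<close>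
  have comult: "comult (\<theta> h) = tensor_map \<theta> \<theta> (comult h)" for h
    by (simp add: \<theta>_def H.comult_antipode H.comult_star tensor_lift_flip tensor_lift_map lin)
      (simp add: tensor_map_def)
  have lift: "tensor_lift f (comult (\<theta> h)) = tensor_lift (\<lambda>a b. f (\<theta> a) (\<theta> b)) (comult h)"
    if "cbilinear f" for f :: "'h \<Rightarrow> 'h \<Rightarrow> 'b::complex_vector" and h
    by (simp add: comult tensor_lift_map that)
  \<comment> \<open>Since \<theta> fixes \<Lambda>, the legs of its coproduct may be replaced by
    their images; this handles the operations built from \<open>comult \<Lambda>\<close>.\<close>
  have lift_\<Lambda>: "tensor_lift f (comult \<Lambda>) = tensor_lift (\<lambda>a b. f (\<theta> a) (\<theta> b)) (comult \<Lambda>)"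
    if "cbilinear f" for f :: "'h \<Rightarrow> 'h \<Rightarrow> 'b::complex_vector"
    using lift[OF that, of \<Lambda>] by (simp only: \<Lambda>)
  have "flip_hopf_star_algebra (assoc_mult mult comult S integ) \<Lambda>
      (assoc_comult mult comult S \<Lambda>) integ S' (inv S' \<circ> \<theta>)"
  proof (rule D.flip_star_of_automorphism[OF bij anti])
    show "\<theta> (assoc_mult mult comult S integ a b)
        = assoc_mult mult comult S integ (\<theta> a) (\<theta> b)" for a b
      by (simp add: assoc_mult_def lift lin additive_tensor_lift[OF additive] scale
          antipode[symmetric] mult[symmetric] integ)
    show "assoc_comult mult comult S \<Lambda> (\<theta> h)
        = tensor_map \<theta> \<theta> (assoc_comult mult comult S \<Lambda> h)" for h
    proof -
      have "tensor_map \<theta> \<theta> (assoc_comult mult comult S \<Lambda> h)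
          = tensor_lift (\<lambda>a b. \<theta> a \<otimes> mult (S (\<theta> b)) (\<theta> h)) (comult \<Lambda>)"
        unfolding H.dcomult_eq tensor_map_def
          additive_tensor_lift[OF tensor_lift_additive[OF balanced]]
        by (simp add: tensor_lift_tensor[OF balanced] mult antipode)
      also have "\<dots> = assoc_comult mult comult S \<Lambda> (\<theta> h)"
        unfolding H.dcomult_eq by (rule lift_\<Lambda>[symmetric]) (intro lin)
      finally show ?thesis ..
    qed
    show "\<theta> (S' h) = S' (\<theta> h)" for h
      unfolding S'_def assoc_antipode_def
      by (subst (2) lift_\<Lambda>)
        (intro lin, simp add: additive_tensor_lift[OF additive] scale mult[symmetric] integ)
    show "\<theta> (\<theta> h) = S' (S' h)" for h
      by (simp add: square \<theta>_def H.antipode_star H.star_star)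
  qed (rule \<Lambda> integ)+
  moreover have "S' \<circ> (inv S' \<circ> \<theta>) = S \<circ> star"
    using bij by (simp add: \<theta>_def fun_eq_iff surj_f_inv_f bij_is_surj)
  ultimately show ?thesis by blast
qed

end
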